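(* Let $d\ge1$ and let $$\hat\tau_d=\Big\{x=(x_1,\dots,x_d)\in\mathbb{R}^d: x_i>0\ (1\le i\le d),\ \sum_{i=1}^dx_i<1\Big\}.$$ Then $$\sup_{v\in\mathbb{P}_1(\hat\tau_d)\setminus\{0\}}\frac{|v|_{H^1(\hat\tau_d)}}{\|v\|_{L^2(\hat\tau_d)}}=(d+1)(d+2)^{1/2},$$ and in particular this supremum is bounded above and below by absolute positive constants times $d^{3/2}$.
   Context: $\mathbb{P}_1(\hat\tau_d)$ is the space of affine functions (polynomials of degree at most one) on $\hat\tau_d$, and $|v|_{H^1(\hat\tau_d)}=\|\nabla v\|_{L^2(\hat\tau_d)}$. *)

theory Defs
  imports "HOL-Analysis.Analysis"
begin

text \<open>
  Since the claim involves constants that are uniform in the dimension \<open>d\<close>, a point of \<open>d\<close>-space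
  is a function on the index set \<open>{1..d}\<close> (extended by \<open>undefined\<close>), and Lebesgue measure
  on \<open>d\<close>-space is the \<open>d\<close>-fold product of \<^const>\<open>lborel\<close>.
\<close>

abbreviation lborel_d :: "nat \<Rightarrow> (nat \<Rightarrow> real) measure" where
  "lborel_d d \<equiv> Pi\<^sub>M {1..d} (\<lambda>_. lborel)"

definition ref_simplex :: "nat \<Rightarrow> (nat \<Rightarrow> real) set" where
  "ref_simplex d = {x \<in> {1..d} \<rightarrow>\<^sub>E UNIV. (\<forall>i\<in>{1..d}. x i > 0) \<and> (\<Sum>i=1..d. x i) < 1}"

text \<open>
  A function on the simplex is represented by any total function with the right values there;
  all notions below depend only on those values, the simplex being open in \<open>d\<close>-space.
\<close>

definition affine_functions :: "nat \<Rightarrow> ((nat \<Rightarrow> real) \<Rightarrow> real) set" where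
  "affine_functions d =
     {v. \<exists>a b. \<forall>x\<in>ref_simplex d. v x = a + (\<Sum>i=1..d. b i * x i)}"

definition nonzero_affine_functions :: "nat \<Rightarrow> ((nat \<Rightarrow> real) \<Rightarrow> real) set" where
  "nonzero_affine_functions d =
     {v \<in> affine_functions d. \<not> (\<forall>x\<in>ref_simplex d. v x = 0)}"

definition partial_deriv :: "nat \<Rightarrow> ((nat \<Rightarrow> real) \<Rightarrow> real) \<Rightarrow> (nat \<Rightarrow> real) \<Rightarrow> real" where
  "partial_deriv i v x = deriv (\<lambda>t. v (x(i := t))) (x i)"

definition L2_norm :: "nat \<Rightarrow> ((nat \<Rightarrow> real) \<Rightarrow> real) \<Rightarrow> real" where
  "L2_norm d v = sqrt (LINT x:ref_simplex d|lborel_d d. (v x)\<^sup>2)"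

text \<open>\<^const>\<open>L2_set\<close> below is the Euclidean norm of the gradient vector at a point.\<close>

definition H1_seminorm :: "nat \<Rightarrow> ((nat \<Rightarrow> real) \<Rightarrow> real) \<Rightarrow> real" where
  "H1_seminorm d v = L2_norm d (\<lambda>x. L2_set (\<lambda>i. partial_deriv i v x) {1..d})"

text \<open>The supremum is taken in \<^typ>\<open>ereal\<close>, so that it is meaningful without a boundedness proof.\<close>

definition sup_ratio :: "nat \<Rightarrow> ereal" where
  "sup_ratio d = (SUP v\<in>nonzero_affine_functions d. ereal (H1_seminorm d v / L2_norm d v))"

end

(* For v = a + b . x, Dirichlet's integral for monomials over the simplex turns |v|^2 and ||v||^2
   into Q / d! and (a^2 + 2 a B / (d+1) + (Q + B^2) / ((d+1) (d+2))) / d!, where Q is the sum of the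
   b_i^2 and B the sum of the b_i.  Minimizing over a and using B^2 <= d Q gives the upper bound;
   b = (1, ..., 1), a = - d / (d+1) is extremal. *)

theory Submission
  imports Defs
begin

section \<open>Dirichlet's integral over scaled simplices\<close>

text \<open>This is the beta integral B(k+1, m+1), scaled to an interval of length \<open>s\<close>.
  Integration by parts trades a power of \<open>x\<close> for a power of \<open>s - x\<close>, so
  the induction on \<open>k\<close> must leave \<open>m\<close> free.\<close>

lemma has_integral_power_mult_power:
  fixes s :: real
  assumes "s \<ge> 0"
  shows "((\<lambda>x. x ^ k * (s - x) ^ m) has_integral
    (fact k * fact m / fact (k + m + 1) * s ^ (k + m + 1))) {0..s}"
proof (induction k arbitrary: m)
  case 0
  have "((\<lambda>x. (s - x) ^ m) has_integral
    (- ((s - s) ^ (m + 1) / real (m + 1)) - (- ((s - 0) ^ (m + 1) / real (m + 1))))) {0..s}"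
  proof (rule fundamental_theorem_of_calculus)
    fix x assume "x \<in> {0..s}"
    have "((\<lambda>x. - ((s - x) ^ (m + 1) / real (m + 1))) has_real_derivative (s - x) ^ m)
        (at x within {0..s})"
      by (rule derivative_eq_intros refl | simp add: field_simps del: of_nat_Suc)+
    thus "((\<lambda>x. - ((s - x) ^ (m + 1) / real (m + 1))) has_vector_derivative (s - x) ^ m)
        (at x within {0..s})"
      by (simp add: has_real_derivative_iff_has_vector_derivative)
  qed fact
  moreover have "fact m / fact (m + 1) = 1 / real (m + 1)"
    by (simp add: divide_simps del: of_nat_Suc)
  ultimately show ?case
    by simp
next
  case (Suc k)
  let ?A = "\<lambda>x. real (k + 1) * (x ^ k * (s - x) ^ (m + 1))"
  let ?B = "\<lambda>x. real (m + 1) * (x ^ (k + 1) * (s - x) ^ m)"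
  let ?F = "\<lambda>x. x ^ (k + 1) * (s - x) ^ (m + 1)"
  have "((\<lambda>x. ?A x - ?B x) has_integral (?F s - ?F 0)) {0..s}"
  proof (rule fundamental_theorem_of_calculus)
    fix x assume "x \<in> {0..s}"
    have "(?F has_real_derivative (?A x - ?B x)) (at x within {0..s})"
      by (rule derivative_eq_intros refl | simp add: algebra_simps)+
    thus "(?F has_vector_derivative (?A x - ?B x)) (at x within {0..s})"
      by (simp add: has_real_derivative_iff_has_vector_derivative)
  qed fact
  \<comment> \<open>Both exponents in \<open>?F\<close> are positive, so \<open>?F\<close> vanishes
    at both endpoints: \<open>?A\<close> and \<open>?B\<close> have the same integral, and the
    induction hypothesis at \<open>m + 1\<close> evaluates \<open>?A\<close>.\<close>
  from has_integral_diff[OF has_integral_mult_right[OF Suc[of "m + 1"], of "real (k + 1)"] this]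
  have "(?B has_integral (real (k + 1) *
      (fact k * fact (m + 1) / fact (k + (m + 1) + 1) * s ^ (k + (m + 1) + 1)))) {0..s}"
    by simp
  from has_integral_mult_right[OF this, of "1 / real (m + 1)"]
  show ?case
    by (simp add: field_simps del: of_nat_Suc)
qed

text \<open>Arbitrary index set and size make the family closed under slicing: fixing one coordinate
  at \<open>y\<close> leaves a simplex of size \<open>s - y\<close> in the remaining ones.\<close>

definition corner_simplex :: "'i set \<Rightarrow> real \<Rightarrow> ('i \<Rightarrow> real) set" where
  "corner_simplex I s = {x \<in> I \<rightarrow>\<^sub>E UNIV. (\<forall>i\<in>I. x i > 0) \<and> (\<Sum>i\<in>I. x i) < s}"

lemma ref_simplex_eq_corner_simplex: "ref_simplex d = corner_simplex {1..d} 1"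
  by (simp add: ref_simplex_def corner_simplex_def)

lemma corner_simplex_measurable [measurable]:
  assumes "finite I"
  shows "corner_simplex I s \<in> sets (Pi\<^sub>M I (\<lambda>_. lborel))"
proof -
  have "corner_simplex I s =
      {x \<in> space (Pi\<^sub>M I (\<lambda>_. lborel)). (\<forall>i\<in>I. x i > 0) \<and> (\<Sum>i\<in>I. x i) < s}"
    by (simp add: corner_simplex_def space_PiM)
  also have "\<dots> \<in> sets (Pi\<^sub>M I (\<lambda>_. lborel))"
    using assms by measurable
  finally show ?thesis .
qed

lemma fun_upd_in_corner_simplex_iff:
  assumes "finite I" "i \<notin> I" "x \<in> I \<rightarrow>\<^sub>E UNIV"
  shows "x(i := y) \<in> corner_simplex (insert i I) s \<longleftrightarrow>
    y \<in> {0<..<s} \<and> x \<in> corner_simplex I (s - y)"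
proof -
  have "(\<Sum>j\<in>insert i I. (x(i := y)) j) = y + (\<Sum>j\<in>I. x j)"
    using assms(1,2) by (simp add: sum_delta_notmem)
  moreover have "(\<forall>j\<in>insert i I. 0 < (x(i := y)) j) \<longleftrightarrow> 0 < y \<and> (\<forall>j\<in>I. 0 < x j)"
    using assms(2) by auto
  moreover have "x(i := y) \<in> insert i I \<rightarrow>\<^sub>E UNIV"
    using assms(3) by (auto simp: PiE_iff extensional_def)
  \<comment> \<open>The other coordinates contribute a nonnegative sum, which forces
    \<open>y < s\<close>.\<close>
  moreover have "(\<forall>j\<in>I. 0 < x j) \<longrightarrow> 0 \<le> (\<Sum>j\<in>I. x j)"
    by (simp add: sum_nonneg less_imp_le)
  ultimately show ?thesis
    using assms(3) unfolding corner_simplex_def mem_Collect_eq greaterThanLessThan_iff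
    by (smt (verit, best))
qed

text \<open>Slicing along one coordinate reduces the dimension: by homogeneity the slice at
  \<open>y\<close> contributes a power of \<open>s - y\<close>, and the outer integral is then a
  beta integral. With nonnegative integrals, Tonelli's theorem needs measurability alone.\<close>

lemma nn_integral_monomial_corner_simplex:
  assumes "finite I" "s > 0"
  shows "(\<integral>\<^sup>+ x. ennreal (\<Prod>i\<in>I. x i ^ k i) * indicator (corner_simplex I s) x
      \<partial>(Pi\<^sub>M I (\<lambda>_. lborel))) =
    ennreal ((\<Prod>i\<in>I. fact (k i)) / fact (card I + (\<Sum>i\<in>I. k i)) * s ^ (card I + (\<Sum>i\<in>I. k i)))"
  using assms
proof (induction I arbitrary: s rule: finite_induct)
  case empty
  \<comment> \<open>The empty product measure is a unit point mass, and its single point lies in the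
    simplex because the empty sum is below \<open>s\<close>.\<close>
  then show ?case
    by (simp add: PiM_empty corner_simplex_def nn_integral_count_space_finite)
next
  case (insert i I s)
  interpret product_sigma_finite "\<lambda>_. lborel"
    by standard
  let ?M = "\<lambda>I. Pi\<^sub>M I (\<lambda>_. lborel :: real measure)"
  let ?m = "card I + (\<Sum>i\<in>I. k i)"
  let ?c = "(\<Prod>i\<in>I. fact (k i)) / fact ?m :: real"
  let ?S = "corner_simplex (insert i I) s"
  have fin [simp]: "finite I" "finite (insert i I)" and notin: "i \<notin> I"
    using insert.hyps by auto
  have [measurable]: "?S \<in> sets (?M (insert i I))"
    by (rule corner_simplex_measurable) simp
  have cs [measurable]: "corner_simplex I t \<in> sets (?M I)" for t
    by (rule corner_simplex_measurable) simp
  \<comment> \<open>Tonelli with the new coordinate \<open>y\<close> outermost, so that the inner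
    integral runs over a slice.\<close>
  have "(\<integral>\<^sup>+ x. ennreal (\<Prod>j\<in>insert i I. x j ^ k j) * indicator ?S x \<partial>?M (insert i I)) =
      (\<integral>\<^sup>+ y. (\<integral>\<^sup>+ x. ennreal (\<Prod>j\<in>insert i I. (x(i := y)) j ^ k j) *
        indicator ?S (x(i := y)) \<partial>?M I) \<partial>lborel)"
    using notin by (intro product_nn_integral_insert_rev) (simp_all, measurable)
  also have "\<dots> = (\<integral>\<^sup>+ y. ennreal (?c * (y ^ k i * (s - y) ^ ?m)) * indicator {0<..<s} y \<partial>lborel)"
  proof (rule nn_integral_cong)
    fix y :: real
    have "(\<integral>\<^sup>+ x. ennreal (\<Prod>j\<in>insert i I. (x(i := y)) j ^ k j) *
          indicator ?S (x(i := y)) \<partial>?M I) =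
        (\<integral>\<^sup>+ x. (ennreal (y ^ k i) * indicator {0<..<s} y) *
          (ennreal (\<Prod>j\<in>I. x j ^ k j) * indicator (corner_simplex I (s - y)) x) \<partial>?M I)"
    proof (rule nn_integral_cong)
      fix x assume "x \<in> space (?M I)"
      then have x: "x \<in> I \<rightarrow>\<^sub>E UNIV"
        by (simp add: space_PiM)
      have "(\<Prod>j\<in>I. (x(i := y)) j ^ k j) = (\<Prod>j\<in>I. x j ^ k j)"
        using notin by (intro prod.cong) auto
      then have prod: "(\<Prod>j\<in>insert i I. (x(i := y)) j ^ k j) = y ^ k i * (\<Prod>j\<in>I. x j ^ k j)"
        using notin by simp
      show "ennreal (\<Prod>j\<in>insert i I. (x(i := y)) j ^ k j) * indicator ?S (x(i := y)) =
          (ennreal (y ^ k i) * indicator {0<..<s} y) *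
          (ennreal (\<Prod>j\<in>I. x j ^ k j) * indicator (corner_simplex I (s - y)) x)"
        unfolding prod using fun_upd_in_corner_simplex_iff[OF fin(1) notin x, of y s]
        by (auto simp: indicator_def ennreal_mult')
    qed
    also have "\<dots> = (ennreal (y ^ k i) * indicator {0<..<s} y) *
        (\<integral>\<^sup>+ x. ennreal (\<Prod>j\<in>I. x j ^ k j) * indicator (corner_simplex I (s - y)) x \<partial>?M I)"
      by (rule nn_integral_cmult) measurable
    also have "\<dots> = ennreal (?c * (y ^ k i * (s - y) ^ ?m)) * indicator {0<..<s} y"
    \<comment> \<open>The induction hypothesis requires a slice of positive size
      \<open>s - y\<close>; outside the interval both sides vanish through the indicator.\<close>
    proof (cases "y \<in> {0<..<s}")
      case True
      then have "0 \<le> ?c * (s - y) ^ ?m"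
        by (intro mult_nonneg_nonneg divide_nonneg_nonneg prod_nonneg) auto
      with True show ?thesis
        by (subst insert.IH) (simp_all add: ennreal_mult'[symmetric] ac_simps)
    qed simp
    finally show "(\<integral>\<^sup>+ x. ennreal (\<Prod>j\<in>insert i I. (x(i := y)) j ^ k j) *
          indicator ?S (x(i := y)) \<partial>?M I) =
        ennreal (?c * (y ^ k i * (s - y) ^ ?m)) * indicator {0<..<s} y" .
  qed
  also have "\<dots> = ennreal (?c * (fact (k i) * fact ?m / fact (k i + ?m + 1) * s ^ (k i + ?m + 1)))"
  proof (rule nn_integral_has_integral_lebesgue')
    show "0 \<le> ?c * (y ^ k i * (s - y) ^ ?m)" if "y \<in> {0<..<s}" for y
      using that by (intro mult_nonneg_nonneg divide_nonneg_nonneg prod_nonneg) auto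
    \<comment> \<open>Passing from the closed to the open interval drops only two endpoints, which
      do not affect the integral.\<close>
    show "((\<lambda>y. ?c * (y ^ k i * (s - y) ^ ?m)) has_integral
        ?c * (fact (k i) * fact ?m / fact (k i + ?m + 1) * s ^ (k i + ?m + 1))) {0<..<s}"
      using has_integral_mult_right[OF has_integral_power_mult_power[of s "k i" ?m]] insert.prems
      by (simp only: has_integral_Icc_iff_Ioo less_imp_le)
  qed
  \<comment> \<open>The beta factor \<open>fact ?m\<close> cancels the denominator of
    \<open>?c\<close>. The extra 1 in the exponent is the growth of the dimension.\<close>
  also have "?c * (fact (k i) * fact ?m / fact (k i + ?m + 1) * s ^ (k i + ?m + 1)) =
      (\<Prod>j\<in>insert i I. fact (k j)) / fact (card (insert i I) + (\<Sum>j\<in>insert i I. k j)) *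
      s ^ (card (insert i I) + (\<Sum>j\<in>insert i I. k j))"
  proof -
    have "card (insert i I) + (\<Sum>j\<in>insert i I. k j) = k i + ?m + 1"
      using notin by simp
    moreover have "(\<Prod>j\<in>insert i I. fact (k j)) = fact (k i) * (\<Prod>j\<in>I. fact (k j) :: real)"
      using notin by simp
    ultimately show ?thesis
      by (simp only:) simp
  qed
  finally show ?case .
qed

section \<open>Moments of the reference simplex up to degree two\<close>

lemma has_bochner_integral_monomial_ref_simplex:
  "has_bochner_integral (lborel_d d) (\<lambda>x. indicator (ref_simplex d) x * (\<Prod>i=1..d. x i ^ k i))
    ((\<Prod>i=1..d. fact (k i)) / fact (d + (\<Sum>i=1..d. k i)))"
proof (rule has_bochner_integral_nn_integral)
  let ?f = "\<lambda>x. indicator (ref_simplex d) x * (\<Prod>i=1..d. x i ^ k i) :: real"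
  have [measurable]: "ref_simplex d \<in> sets (lborel_d d)"
    by (simp add: ref_simplex_eq_corner_simplex corner_simplex_measurable)
  show "?f \<in> borel_measurable (lborel_d d)"
    by measurable
  have "0 \<le> ?f x" for x
    by (auto simp: indicator_def ref_simplex_def less_imp_le intro!: prod_nonneg)
  then show "AE x in lborel_d d. 0 \<le> ?f x"
    by simp
  have "(\<integral>\<^sup>+ x. ennreal (?f x) \<partial>lborel_d d) = (\<integral>\<^sup>+ x. ennreal (\<Prod>i=1..d. x i ^ k i) *
      indicator (corner_simplex {1..d} 1) x \<partial>lborel_d d)"
    unfolding ref_simplex_eq_corner_simplex
    by (intro nn_integral_cong) (auto simp: indicator_def)
  then show "(\<integral>\<^sup>+ x. ennreal (?f x) \<partial>lborel_d d) =
      ennreal ((\<Prod>i=1..d. fact (k i)) / fact (d + (\<Sum>i=1..d. k i)))"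
    by (simp add: nn_integral_monomial_corner_simplex)
qed (simp add: prod_nonneg)

lemma has_bochner_integral_one_ref_simplex:
  "has_bochner_integral (lborel_d d) (\<lambda>x. indicator (ref_simplex d) x) (1 / fact d :: real)"
  using has_bochner_integral_monomial_ref_simplex[of d "\<lambda>_. 0"] by simp

lemma has_bochner_integral_coord_ref_simplex:
  assumes "i \<in> {1..d}"
  shows "has_bochner_integral (lborel_d d) (\<lambda>x. indicator (ref_simplex d) x * x i)
    (1 / fact (d + 1))"
proof -
  let ?k = "\<lambda>l. if l = i then 1 else 0 :: nat"
  have "(\<Prod>l=1..d. x l ^ ?k l) = (\<Prod>l=1..d. if l = i then x l else 1)" for x :: "nat \<Rightarrow> real"
    by (intro prod.cong) auto
  then have "(\<Prod>l=1..d. x l ^ ?k l) = x i" for x :: "nat \<Rightarrow> real"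
    using assms by simp
  moreover have "(\<Prod>l=1..d. fact (?k l)) = (1 :: real)"
    by (intro prod.neutral) auto
  moreover have "(\<Sum>l=1..d. ?k l) = 1"
    using assms by simp
  ultimately show ?thesis
    using has_bochner_integral_monomial_ref_simplex[of d ?k] by (simp only:)
qed

text \<open>The exponent vector is a sum of two unit vectors. If they coincide, the exponent 2 has
  factorial 2, whence the doubled diagonal moments.\<close>

lemma has_bochner_integral_coord_mult_ref_simplex:
  assumes "i \<in> {1..d}" "j \<in> {1..d}"
  shows "has_bochner_integral (lborel_d d) (\<lambda>x. indicator (ref_simplex d) x * (x i * x j))
    ((if i = j then 2 else 1) / fact (d + 2))"
proof -
  let ?k = "\<lambda>l. (if l = i then 1 else 0) + (if l = j then 1 else 0) :: nat"
  have "(\<Prod>l=1..d. x l ^ ?k l) =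
      (\<Prod>l=1..d. (if l = i then x l else 1) * (if l = j then x l else 1))" for x :: "nat \<Rightarrow> real"
    by (intro prod.cong) auto
  then have "(\<Prod>l=1..d. x l ^ ?k l) = x i * x j" for x :: "nat \<Rightarrow> real"
    using assms by (simp add: prod.distrib)
  moreover have "(\<Prod>l=1..d. fact (?k l)) =
      (\<Prod>l=1..d. if l = i then (if i = j then 2 else 1) else 1 :: real)"
    by (intro prod.cong) auto
  then have "(\<Prod>l=1..d. fact (?k l)) = (if i = j then 2 else 1 :: real)"
    using assms by simp
  moreover have "(\<Sum>l=1..d. ?k l) = 2"
    using assms by (simp add: sum.distrib)
  ultimately show ?thesis
    using has_bochner_integral_monomial_ref_simplex[of d ?k] by (simp only:)
qed

section \<open>Norm and seminorm of an affine function\<close>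

text \<open>Expanding the square leaves only moments of degree at most two, which are integrated
  term by term. The factorials are rewritten over the common denominator \<open>fact d\<close>,
  which later cancels in the ratio.\<close>

lemma L2_norm_affine:
  assumes v: "\<forall>x\<in>ref_simplex d. v x = a + (\<Sum>i=1..d. b i * x i)"
  shows "(L2_norm d v)\<^sup>2 = (a\<^sup>2 + 2 * a * (\<Sum>i=1..d. b i) / (real d + 1) +
    ((\<Sum>i=1..d. (b i)\<^sup>2) + (\<Sum>i=1..d. b i)\<^sup>2) / ((real d + 1) * (real d + 2))) / fact d"
proof -
  let ?i = "\<lambda>x. indicator (ref_simplex d) x :: real"
  let ?q = "\<lambda>i j. if i = j then 2 else 1 :: real"
  let ?J = "a\<^sup>2 * (1 / fact d) + (\<Sum>i=1..d. 2 * a * b i * (1 / fact (d + 1))) +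
    (\<Sum>i=1..d. \<Sum>j=1..d. b i * b j * (?q i j / fact (d + 2)))"
  have "has_bochner_integral (lborel_d d) (\<lambda>x. a\<^sup>2 * ?i x +
      (\<Sum>i=1..d. 2 * a * b i * (?i x * x i)) +
      (\<Sum>i=1..d. \<Sum>j=1..d. b i * b j * (?i x * (x i * x j)))) ?J"
    by (intro has_bochner_integral_add has_bochner_integral_sum has_bochner_integral_mult_right
        has_bochner_integral_one_ref_simplex has_bochner_integral_coord_ref_simplex
        has_bochner_integral_coord_mult_ref_simplex)
  also have "(\<lambda>x. a\<^sup>2 * ?i x + (\<Sum>i=1..d. 2 * a * b i * (?i x * x i)) +
      (\<Sum>i=1..d. \<Sum>j=1..d. b i * b j * (?i x * (x i * x j)))) = (\<lambda>x. ?i x *\<^sub>R (v x)\<^sup>2)"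
  proof
    fix x
    have "(a + (\<Sum>i=1..d. b i * x i))\<^sup>2 = a\<^sup>2 + (\<Sum>i=1..d. 2 * a * b i * x i) +
        (\<Sum>i=1..d. \<Sum>j=1..d. b i * b j * (x i * x j))"
      by (simp add: power2_sum power2_eq_square[of "sum _ _"] sum_product sum_distrib_left ac_simps)
    then show "a\<^sup>2 * ?i x + (\<Sum>i=1..d. 2 * a * b i * (?i x * x i)) +
        (\<Sum>i=1..d. \<Sum>j=1..d. b i * b j * (?i x * (x i * x j))) = ?i x *\<^sub>R (v x)\<^sup>2"
      by (auto simp: indicator_def v)
  qed
  finally have int: "(LINT x:ref_simplex d|lborel_d d. (v x)\<^sup>2) = ?J"
    unfolding set_lebesgue_integral_def by (rule has_bochner_integral_integral_eq)
  \<comment> \<open>Nonnegativity lets the square undo the square root in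
    \<open>L2_norm\<close>.\<close>
  have "0 \<le> (LINT x:ref_simplex d|lborel_d d. (v x)\<^sup>2)"
    unfolding set_lebesgue_integral_def by (intro integral_nonneg_AE) auto
  then have "(L2_norm d v)\<^sup>2 = ?J"
    unfolding L2_norm_def int by simp
  also have "(\<Sum>i=1..d. \<Sum>j=1..d. b i * b j * (?q i j / fact (d + 2))) =
      ((\<Sum>i=1..d. (b i)\<^sup>2) + (\<Sum>i=1..d. b i)\<^sup>2) / fact (d + 2)"
  proof -
    \<comment> \<open>The matrix \<open>?q\<close> is the identity plus the all-ones matrix: the
      first part gives the sum of squares, the second the square of the sum.\<close>
    have "(\<Sum>i=1..d. \<Sum>j=1..d. b i * b j * ?q i j) =
        (\<Sum>i=1..d. \<Sum>j=1..d. (if i = j then b i * b j else 0) + b i * b j)"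
      by (intro sum.cong) auto
    also have "\<dots> = (\<Sum>i=1..d. (b i)\<^sup>2) + (\<Sum>i=1..d. b i)\<^sup>2"
      by (simp add: sum.distrib sum_product power2_eq_square)
    finally show ?thesis
      by (simp add: sum_divide_distrib[symmetric] del: fact_Suc)
  qed
  also have "(\<Sum>i=1..d. 2 * a * b i * (1 / fact (d + 1))) =
      2 * a * (\<Sum>i=1..d. b i) / fact (d + 1)"
    by (simp add: sum_divide_distrib[symmetric] sum_distrib_left del: fact_Suc)
  also have "fact (d + 1) = (real d + 1) * (fact d :: real)"
    by simp
  also have "fact (d + 2) = ((real d + 1) * (real d + 2)) * (fact d :: real)"
    by (simp add: algebra_simps)
  finally show ?thesis
    by (simp add: add_divide_distrib del: of_nat_Suc of_nat_add)
qed

text \<open>Since \<open>v\<close> is prescribed on the simplex only, the derivative is computed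
  from its values near \<open>x\<close>: the simplex meets the line through \<open>x\<close> in
  direction \<open>i\<close> in an open interval around \<open>x i\<close>.\<close>

lemma partial_deriv_affine:
  assumes v: "\<forall>x\<in>ref_simplex d. v x = a + (\<Sum>i=1..d. b i * x i)"
    and x: "x \<in> ref_simplex d" and i: "i \<in> {1..d}"
  shows "partial_deriv i v x = b i"
proof -
  let ?rest = "\<lambda>c. \<Sum>j\<in>{1..d}-{i}. c j"
  have split: "(\<Sum>j=1..d. c j) = c i + ?rest c" for c :: "nat \<Rightarrow> real"
    using i by (simp add: sum.remove)
  have "x i \<in> {0<..<1 - ?rest x}"
    using x i split[of x] by (auto simp: ref_simplex_def)
  then have "\<forall>\<^sub>F t in nhds (x i). t \<in> {0<..<1 - ?rest x}"
    by (intro eventually_nhds_in_open) auto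
  then have "\<forall>\<^sub>F t in nhds (x i). v (x(i := t)) = (a + ?rest (\<lambda>j. b j * x j)) + b i * t"
  proof eventually_elim
    case (elim t)
    have "x(i := t) \<in> ref_simplex d"
      using x i elim split[of "x(i := t)"] by (auto simp: ref_simplex_def PiE_iff extensional_def)
    then show ?case
      using split[of "\<lambda>j. b j * (x(i := t)) j"] by (simp add: v)
  qed
  then have "deriv (\<lambda>t. v (x(i := t))) (x i) =
      deriv (\<lambda>t. (a + ?rest (\<lambda>j. b j * x j)) + b i * t) (x i)"
    by (rule deriv_cong_ev) simp
  also have "\<dots> = b i"
    by (rule DERIV_imp_deriv) (auto intro!: derivative_eq_intros)
  finally show ?thesis
    by (simp add: partial_deriv_def)
qed

text \<open>On the simplex the gradient is the constant vector \<open>b\<close>, so its length is an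
  affine function with zero linear part and the formula for \<open>L2_norm\<close> applies to
  it.\<close>

lemma H1_seminorm_affine:
  assumes v: "\<forall>x\<in>ref_simplex d. v x = a + (\<Sum>i=1..d. b i * x i)"
  shows "(H1_seminorm d v)\<^sup>2 = (\<Sum>i=1..d. (b i)\<^sup>2) / fact d"
proof -
  have "L2_set (\<lambda>i. partial_deriv i v x) {1..d} = L2_set b {1..d}"
    if "x \<in> ref_simplex d" for x
    using partial_deriv_affine[OF v that] by (simp add: L2_set_def)
  then have "\<forall>x\<in>ref_simplex d. L2_set (\<lambda>i. partial_deriv i v x) {1..d} =
      L2_set b {1..d} + (\<Sum>i=1..d. 0 * x i)"
    by simp
  from L2_norm_affine[of d _ "L2_set b {1..d}" "\<lambda>_. 0", OF this]
  show ?thesis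
    by (simp add: H1_seminorm_def L2_set_def sum_nonneg)
qed

lemma L2_norm_nonneg: "0 \<le> L2_norm d v"
  unfolding L2_norm_def set_lebesgue_integral_def
  by (intro real_sqrt_ge_zero integral_nonneg_AE) auto

lemma H1_seminorm_nonneg: "0 \<le> H1_seminorm d v"
  by (simp add: H1_seminorm_def L2_norm_nonneg)

section \<open>The upper bound\<close>

text \<open>Completing the square in \<open>a\<close> gives \<open>(a + B / (d + 1))\<^sup>2\<close>
  plus a positive multiple of \<open>d * Q - B\<^sup>2\<close>, which the hypothesis makes
  nonnegative.\<close>

lemma affine_quadratic_form_ge:
  fixes a B Q :: real
  assumes "B\<^sup>2 \<le> real d * Q"
  shows "Q / ((real d + 1)\<^sup>2 * (real d + 2)) \<le>
    a\<^sup>2 + 2 * a * B / (real d + 1) + (Q + B\<^sup>2) / ((real d + 1) * (real d + 2))"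
proof -
  define p where "p = real d + 1"
  have p: "p > 0" "real d = p - 1"
    by (auto simp: p_def)
  have "a\<^sup>2 + 2 * a * B / p + (Q + B\<^sup>2) / (p * (p + 1)) - Q / (p\<^sup>2 * (p + 1)) =
      (a + B / p)\<^sup>2 + ((p - 1) * Q - B\<^sup>2) / (p\<^sup>2 * (p + 1))"
    using p(1) by (simp add: divide_simps) (simp add: power2_eq_square algebra_simps)
  moreover have "0 \<le> ((p - 1) * Q - B\<^sup>2) / (p\<^sup>2 * (p + 1))"
    using assms p by auto
  ultimately show ?thesis
    by (simp add: p_def add.commute) (smt (verit) zero_le_power2)
qed

text \<open>This compares squares, where both norms are explicit in the coefficients. The product
  form covers functions of zero norm as well.\<close>

lemma H1_seminorm_affine_le:
  assumes "v \<in> affine_functions d"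
  shows "H1_seminorm d v \<le> (real d + 1) * sqrt (real d + 2) * L2_norm d v"
proof -
  from assms obtain a b where v: "\<forall>x\<in>ref_simplex d. v x = a + (\<Sum>i=1..d. b i * x i)"
    unfolding affine_functions_def by blast
  let ?K = "(real d + 1)\<^sup>2 * (real d + 2)"
  let ?Q = "\<Sum>i=1..d. (b i)\<^sup>2"
  let ?B = "\<Sum>i=1..d. b i"
  \<comment> \<open>Cauchy-Schwarz for \<open>b\<close> against the all-ones vector.\<close>
  have "?B\<^sup>2 \<le> real d * ?Q"
    using sum_squared_le_sum_of_squares[of b "{1..d}"] by (simp add: mult.commute)
  from affine_quadratic_form_ge[OF this, of a]
  have "?Q / ?K / fact d \<le> (L2_norm d v)\<^sup>2"
    unfolding L2_norm_affine[OF v] by (intro divide_right_mono) (auto simp: add.commute)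
  then have "(H1_seminorm d v)\<^sup>2 \<le> ?K * (L2_norm d v)\<^sup>2"
    unfolding H1_seminorm_affine[OF v]
    by (simp add: pos_divide_le_eq divide_divide_eq_left' ac_simps)
  also have "\<dots> = ((real d + 1) * sqrt (real d + 2) * L2_norm d v)\<^sup>2"
    by (simp add: power_mult_distrib)
  finally show ?thesis
    by (rule power2_le_imp_le) (auto intro!: mult_nonneg_nonneg L2_norm_nonneg)
qed

section \<open>Sharpness, the supremum and its growth\<close>

text \<open>Both estimates in the upper bound are tight here: equal slopes give equality in
  Cauchy-Schwarz, and the constant term \<open>- d / (d + 1)\<close> makes the completed square
  vanish.\<close>

lemma H1_L2_ratio_extremal:
  assumes "d \<ge> 1"
  defines "v \<equiv> \<lambda>x. - (real d / (real d + 1)) + (\<Sum>i=1..d. x i)"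
  shows "v \<in> nonzero_affine_functions d"
    and "H1_seminorm d v / L2_norm d v = (real d + 1) * sqrt (real d + 2)"
proof -
  have v: "\<forall>x\<in>ref_simplex d. v x = - (real d / (real d + 1)) + (\<Sum>i=1..d. 1 * x i)"
    by (simp add: v_def)
  have H: "(H1_seminorm d v)\<^sup>2 = real d / fact d"
    using H1_seminorm_affine[OF v] by simp
  define p where "p = real d + 1"
  have p: "p > 0" "real d = p - 1"
    by (auto simp: p_def)
  \<comment> \<open>With all slopes equal to 1, their sum and the sum of their squares are both
    \<open>p - 1\<close>.\<close>
  have "(L2_norm d v)\<^sup>2 = ((- ((p - 1) / p))\<^sup>2 + 2 * (- ((p - 1) / p)) * (p - 1) / p +
      ((p - 1) + (p - 1)\<^sup>2) / (p * (p + 1))) / fact d"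
    using L2_norm_affine[OF v] by (simp add: p_def add_ac)
  also have "\<dots> = (p - 1) / (p\<^sup>2 * (p + 1)) / fact d"
    using p(1) by (simp add: divide_simps) (simp add: power2_eq_square algebra_simps)
  finally have L: "(L2_norm d v)\<^sup>2 = real d / ((real d + 1)\<^sup>2 * (real d + 2)) / fact d"
    by (simp add: p_def add_ac)
  \<comment> \<open>Here \<open>d \<ge> 1\<close> matters: for \<open>d = 0\<close> the function
    \<open>v\<close> is zero.\<close>
  have L0: "L2_norm d v \<noteq> 0"
    using L assms(1) by auto
  have "(H1_seminorm d v / L2_norm d v)\<^sup>2 = ((real d + 1) * sqrt (real d + 2))\<^sup>2"
    unfolding power_divide H L using assms(1) by (simp add: power_mult_distrib)
  then show "H1_seminorm d v / L2_norm d v = (real d + 1) * sqrt (real d + 2)"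
    by (rule power2_eq_imp_eq) (auto intro!: divide_nonneg_nonneg L2_norm_nonneg H1_seminorm_nonneg)
  have "\<not> (\<forall>x\<in>ref_simplex d. v x = 0)"
  proof
    assume "\<forall>x\<in>ref_simplex d. v x = 0"
    \<comment> \<open>A function vanishing on the simplex also has the affine representation with
      all coefficients zero, so the norm formula yields 0.\<close>
    then have "(L2_norm d v)\<^sup>2 = 0"
      using L2_norm_affine[of d v 0 "\<lambda>_. 0"] by simp
    with L0 show False
      by simp
  qed
  moreover have "v \<in> affine_functions d"
    unfolding affine_functions_def mem_Collect_eq using v by (intro exI)
  ultimately show "v \<in> nonzero_affine_functions d"
    by (simp add: nonzero_affine_functions_def)
qed

lemma sup_ratio_eq:
  assumes "d \<ge> 1"
  shows "sup_ratio d = ereal ((real d + 1) * sqrt (real d + 2))"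
  unfolding sup_ratio_def
proof (rule antisym)
  show "(SUP v\<in>nonzero_affine_functions d. ereal (H1_seminorm d v / L2_norm d v))
      \<le> ereal ((real d + 1) * sqrt (real d + 2))"
  proof (rule SUP_least)
    fix v assume "v \<in> nonzero_affine_functions d"
    then have "H1_seminorm d v \<le> (real d + 1) * sqrt (real d + 2) * L2_norm d v"
      by (intro H1_seminorm_affine_le) (simp add: nonzero_affine_functions_def)
    then show "ereal (H1_seminorm d v / L2_norm d v) \<le> ereal ((real d + 1) * sqrt (real d + 2))"
      \<comment> \<open>If the norm is 0, the quotient is 0 by the convention for division, and the
        bound is trivial.\<close>
      using L2_norm_nonneg[of d v] by (cases "L2_norm d v = 0") (auto simp: divide_le_eq)
  qed
  show "ereal ((real d + 1) * sqrt (real d + 2)) \<le>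
      (SUP v\<in>nonzero_affine_functions d. ereal (H1_seminorm d v / L2_norm d v))"
    using SUP_upper[OF H1_L2_ratio_extremal(1)[OF assms],
        of "\<lambda>v. ereal (H1_seminorm d v / L2_norm d v)"]
    unfolding H1_L2_ratio_extremal(2)[OF assms] .
qed

theorem lemma4p8:
  shows "(\<forall>d::nat. d \<ge> 1 \<longrightarrow> sup_ratio d = ereal ((real d + 1) * sqrt (real d + 2))) \<and>
    (\<exists>c C::real. c > 0 \<and> C > 0 \<and>
      (\<forall>d::nat. d \<ge> 1 \<longrightarrow>
        ereal (c * real d powr (3/2)) \<le> sup_ratio d \<and>
        sup_ratio d \<le> ereal (C * real d powr (3/2))))"
proof -
  \<comment> \<open>For \<open>d \<ge> 1\<close>, \<open>d + 1 \<le> 2 * d\<close> and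
    \<open>d + 2 \<le> 4 * d\<close>; the factor 4 under the root becomes 2, so the upper constant
    is 2 * 2 = 4. The lower constant 1 comes from dropping the summands 1 and 2.\<close>
  have bounds: "1 * real d powr (3/2) \<le> (real d + 1) * sqrt (real d + 2) \<and>
      (real d + 1) * sqrt (real d + 2) \<le> 4 * real d powr (3/2)" if "d \<ge> 1" for d :: nat
  proof -
    have "real d powr (3/2) = real d powr (1 + 1/2)"
      by simp
    also have "\<dots> = real d * sqrt (real d)"
      using that unfolding powr_add by (simp add: powr_half_sqrt)
    finally have eq: "real d powr (3/2) = real d * sqrt (real d)" .
    have "real d * sqrt (real d) \<le> (real d + 1) * sqrt (real d + 2)"
      by (intro mult_mono) auto
    moreover have "(real d + 1) * sqrt (real d + 2) \<le> (2 * real d) * sqrt (4 * real d)"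
      using that by (intro mult_mono) auto
    ultimately show ?thesis
      by (simp add: eq real_sqrt_mult)
  qed
  show ?thesis
    using bounds by (intro conjI exI[of _ 1] exI[of _ 4]) (auto simp: sup_ratio_eq)
qed

end
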